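(* Let $r>1$ be any real number and let $d_n=r^n$ for all $n\in\mathbb N_0$. Then $\mathscr M(h_d)=h_d$.
   Context: All sequences are complex and indexed by $\mathbb N_0=\{0,1,2,\dots\}$. For a weight $d=(d_n)$ of positive reals (increasing and unbounded), $h_d=\{x\in\mathbb C^{\mathbb N_0}:\sum_{n=0}^\infty d_n|x_n-x_{n+1}|<\infty,\ \lim_n x_n=0\}$. The convolution is $(a*x)_n=\sum_{k=0}^n a_{n-k}x_k$. The multiplier of a sequence space $X$ is $\mathscr M(X)=\{a\in\mathbb C^{\mathbb N_0}: a*x\in X\text{ for all }x\in X\}$. *)

theory Defs
  imports "HOL-Analysis.Analysis"
begin

text \<open>
  The space \<open>h_d\<close> is intended for weights \<open>d\<close> that are positive, increasing and unbounded; these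
  conditions are not built into the definition.
\<close>

definition hahn_space :: "(nat \<Rightarrow> real) \<Rightarrow> (nat \<Rightarrow> complex) set" where
  "hahn_space d = {x. summable (\<lambda>n. d n * norm (x n - x (Suc n))) \<and> x \<longlonglongrightarrow> 0}"

definition seq_conv :: "(nat \<Rightarrow> complex) \<Rightarrow> (nat \<Rightarrow> complex) \<Rightarrow> nat \<Rightarrow> complex" where
  "seq_conv a x n = (\<Sum>k\<le>n. a (n - k) * x k)"

definition multipliers :: "(nat \<Rightarrow> complex) set \<Rightarrow> (nat \<Rightarrow> complex) set" where
  "multipliers X = {a. \<forall>x\<in>X. seq_conv a x \<in> X}"

end

theory Submission
  imports Defs
begin

text \<open>
  For geometric weights, \<open>h_d\<close> is the weighted space of all \<open>x\<close> with
  \<open>(\<Sum>n. r ^ n * norm (x n)) < \<infinity>\<close>. Since \<open>r ^ n = r ^ (n - k) * r ^ k\<close>, this space is closed under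
  convolution, and it contains the unit \<open>(1, 0, 0, \<dots>)\<close> of convolution.
\<close>

text \<open>Since \<open>x\<close> tends to 0, \<open>x N\<close> is the telescoping sum of its
  differences from \<open>N\<close> on. The weights increase, so replacing \<open>r ^ N\<close> by
  \<open>r ^ k\<close> for k \<ge> N only enlarges the bound. The estimate later controls the
  boundary term of an index shift.\<close>

lemma weighted_norm_le_weighted_variation:
  fixes x :: "nat \<Rightarrow> complex"
  assumes r: "r > 1"
    and sm: "summable (\<lambda>n. r ^ n * norm (x n - x (Suc n)))"
    and lim: "x \<longlonglongrightarrow> 0"
  shows "r ^ N * norm (x N) \<le> (\<Sum>n. r ^ n * norm (x n - x (Suc n)))" (is "_ \<le> ?D")
proof -
  \<comment> \<open>The telescoping is cut off after \<open>m\<close> steps. The remainder keeps the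
    fixed weight \<open>r ^ N\<close>, so it vanishes as \<open>m\<close> grows; with weight
    \<open>r ^ (N + m)\<close> this would not be clear.\<close>
  have tele: "r ^ N * norm (x N)
      \<le> (\<Sum>k=N..<N+m. r ^ k * norm (x k - x (Suc k))) + r ^ N * norm (x (N + m))" for m
  proof (induction m)
    case 0
    show ?case by simp
  next
    case (Suc m)
    let ?\<Delta> = "norm (x (N + m) - x (Suc (N + m)))"
    have "norm (x (N + m)) \<le> norm (x (Suc (N + m))) + ?\<Delta>"
      by (rule norm_triangle_sub)
    then have "r ^ N * norm (x (N + m)) \<le> r ^ N * ?\<Delta> + r ^ N * norm (x (Suc (N + m)))"
      using r by (simp add: distrib_left [symmetric])
    moreover have "r ^ N * ?\<Delta> \<le> r ^ (N + m) * ?\<Delta>"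
      using r by (intro mult_right_mono power_increasing) auto
    ultimately show ?case
      using Suc.IH by simp
  qed
  have "(\<Sum>k=N..<N+m. r ^ k * norm (x k - x (Suc k))) \<le> ?D" for m
    using sm r by (intro sum_le_suminf) auto
  then have "r ^ N * norm (x N) \<le> ?D + r ^ N * norm (x (N + m))" for m
    using tele [of m] by (meson add_right_mono order_trans)
  moreover have "(\<lambda>m. ?D + r ^ N * norm (x (N + m))) \<longlonglongrightarrow> ?D + r ^ N * 0"
    using LIMSEQ_ignore_initial_segment [OF lim, of N]
    by (intro tendsto_intros tendsto_norm_zero) (simp add: add.commute)
  ultimately show ?thesis
    by (intro LIMSEQ_le_const [of "\<lambda>m. ?D + r ^ N * norm (x (N + m))"]) auto
qed

text \<open>From left to right, the triangle inequality for \<open>x n\<close> is multiplied by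
  \<open>r ^ Suc n\<close>: the left side becomes \<open>r\<close> times the weighted term, while
  the right side contains the next weighted term. Summing gives a bound of r S by S plus controlled
  terms, and r > 1 lets S be absorbed. The converse is the triangle inequality for
  differences.\<close>

lemma hahn_space_geometric_iff:
  fixes x :: "nat \<Rightarrow> complex"
  assumes r: "r > 1"
  shows "x \<in> hahn_space (\<lambda>n. r ^ n) \<longleftrightarrow> summable (\<lambda>n. r ^ n * norm (x n))"
proof
  assume "x \<in> hahn_space (\<lambda>n. r ^ n)"
  then have sm: "summable (\<lambda>n. r ^ n * norm (x n - x (Suc n)))" and lim: "x \<longlonglongrightarrow> 0"
    by (auto simp: hahn_space_def)
  define D where "D = (\<Sum>n. r ^ n * norm (x n - x (Suc n)))"
  \<comment> \<open>The constant comes from (r - 1) S \<le> r D + D: the variation contributes r D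
    and the boundary term at \<open>N\<close> contributes D.\<close>
  have bound: "(\<Sum>n<N. r ^ n * norm (x n)) \<le> (r + 1) * D / (r - 1)" for N
  proof -
    let ?S = "\<Sum>n<N. r ^ n * norm (x n)"
    let ?V = "\<Sum>n<N. r ^ n * norm (x n - x (Suc n))"
    have "r * ?S \<le> (\<Sum>n<N. r * (r ^ n * norm (x n - x (Suc n))) + r ^ Suc n * norm (x (Suc n)))"
      unfolding sum_distrib_left
    proof (rule sum_mono)
      fix n
      have "norm (x n) \<le> norm (x (Suc n)) + norm (x n - x (Suc n))"
        by (rule norm_triangle_sub)
      then have "r ^ Suc n * norm (x n) \<le> r ^ Suc n * (norm (x (Suc n)) + norm (x n - x (Suc n)))"
        using r by (intro mult_left_mono) auto
      then show "r * (r ^ n * norm (x n))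
          \<le> r * (r ^ n * norm (x n - x (Suc n))) + r ^ Suc n * norm (x (Suc n))"
        by (simp add: algebra_simps)
    qed
    also have "\<dots> = r * ?V + (\<Sum>n<N. r ^ Suc n * norm (x (Suc n)))"
      by (simp only: sum.distrib sum_distrib_left)
    also have "(\<Sum>n<N. r ^ Suc n * norm (x (Suc n))) = ?S + r ^ N * norm (x N) - norm (x 0)"
      using sum.lessThan_Suc_shift [of "\<lambda>n. r ^ n * norm (x n)" N] by simp
    finally have "r * ?S \<le> r * ?V + (?S + r ^ N * norm (x N) - norm (x 0))" .
    moreover have "r ^ N * norm (x N) \<le> D"
      unfolding D_def by (rule weighted_norm_le_weighted_variation [OF r sm lim])
    moreover have "?V \<le> D"
      unfolding D_def using sm r by (intro sum_le_suminf) auto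
    then have "r * ?V \<le> r * D"
      using r by simp
    ultimately have "r * ?S \<le> r * D + (?S + D)"
      using norm_ge_zero [of "x 0"] by linarith
    then show ?thesis
      using r by (simp add: field_simps)
  qed
  show "summable (\<lambda>n. r ^ n * norm (x n))"
  proof (rule bounded_imp_summable)
    show "(\<Sum>n\<le>N. r ^ n * norm (x n)) \<le> (r + 1) * D / (r - 1)" for N
      using bound [of "Suc N"] by (simp only: lessThan_Suc_atMost)
  qed (use r in auto)
next
  assume sm: "summable (\<lambda>n. r ^ n * norm (x n))"
  have "summable (\<lambda>n. r ^ n * norm (x n) + r ^ Suc n * norm (x (Suc n)))"
    using sm summable_Suc_iff [of "\<lambda>n. r ^ n * norm (x n)"] by (intro summable_add) auto
  then have "summable (\<lambda>n. r ^ n * norm (x n - x (Suc n)))"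
  proof (rule summable_comparison_test')
    fix n
    have "norm (x n - x (Suc n)) \<le> norm (x n) + norm (x (Suc n))"
      by (rule norm_triangle_ineq4)
    then have "r ^ n * norm (x n - x (Suc n)) \<le> r ^ n * norm (x n) + r ^ n * norm (x (Suc n))"
      using r by (simp add: distrib_left [symmetric])
    also have "r ^ n * norm (x (Suc n)) \<le> r ^ Suc n * norm (x (Suc n))"
      using r by (intro mult_right_mono power_increasing) auto
    finally show "norm (r ^ n * norm (x n - x (Suc n)))
        \<le> r ^ n * norm (x n) + r ^ Suc n * norm (x (Suc n))"
      using r by simp
  qed
  moreover have "x \<longlonglongrightarrow> 0"
  \<comment> \<open>All weights are at least 1, so \<open>norm (x n)\<close> lies below the terms of
    a convergent series.\<close>
  proof (rule Lim_null_comparison [OF always_eventually summable_LIMSEQ_zero [OF sm]], rule allI)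
    fix n
    show "norm (x n) \<le> r ^ n * norm (x n)"
      using r mult_right_mono [OF one_le_power [of r n] norm_ge_zero [of "x n"]] by simp
  qed
  ultimately show "x \<in> hahn_space (\<lambda>n. r ^ n)"
    by (simp add: hahn_space_def)
qed

text \<open>Splitting the weight between the two factors bounds the weighted convolution termwise by
  the Cauchy product of two convergent series with nonnegative terms.\<close>

lemma summable_weighted_seq_conv:
  fixes a x :: "nat \<Rightarrow> complex"
  assumes r: "r \<ge> 0"
    and a: "summable (\<lambda>n. r ^ n * norm (a n))"
    and x: "summable (\<lambda>n. r ^ n * norm (x n))"
  shows "summable (\<lambda>n. r ^ n * norm (seq_conv a x n))"
proof -
  have "summable (\<lambda>n. \<Sum>k\<le>n. (r ^ k * norm (x k)) * (r ^ (n - k) * norm (a (n - k))))"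
    using a x r by (intro summable_Cauchy_product) auto
  then show ?thesis
  proof (rule summable_comparison_test')
    fix n
    have "norm (seq_conv a x n) \<le> (\<Sum>k\<le>n. norm (a (n - k)) * norm (x k))"
      unfolding seq_conv_def by (rule sum_norm_le) (simp add: norm_mult)
    then have "r ^ n * norm (seq_conv a x n) \<le> r ^ n * (\<Sum>k\<le>n. norm (a (n - k)) * norm (x k))"
      using r by (intro mult_left_mono) auto
    also have "\<dots> = (\<Sum>k\<le>n. (r ^ k * norm (x k)) * (r ^ (n - k) * norm (a (n - k))))"
      unfolding sum_distrib_left
    proof (rule sum.cong [OF refl])
      fix k
      assume "k \<in> {..n}"
      then have "r ^ n = r ^ k * r ^ (n - k)"
        by (simp flip: power_add)
      then show "r ^ n * (norm (a (n - k)) * norm (x k))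
          = (r ^ k * norm (x k)) * (r ^ (n - k) * norm (a (n - k)))"
        by (simp add: mult_ac)
    qed
    finally show "norm (r ^ n * norm (seq_conv a x n))
        \<le> (\<Sum>k\<le>n. (r ^ k * norm (x k)) * (r ^ (n - k) * norm (a (n - k))))"
      using r by simp
  qed
qed

lemma seq_conv_unit: "seq_conv a (\<lambda>n. if n = 0 then 1 else 0) = a"
  by (rule ext) (simp add: seq_conv_def if_distrib [of "\<lambda>y. _ * y"] sum.delta cong: if_cong)

theorem theorem5p3:
  fixes r :: real and d :: "nat \<Rightarrow> real"
  assumes "r > 1"
    and "\<And>n. d n = r ^ n"
  shows "multipliers (hahn_space d) = hahn_space d"
proof -
  have d: "d = (\<lambda>n. r ^ n)"
    using assms(2) by auto
  let ?e = "\<lambda>n::nat. if n = 0 then 1 else 0 :: complex"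
  have "summable (\<lambda>n. r ^ n * norm (?e n))"
    by (rule summable_finite [of "{0}"]) auto
  then have unit: "?e \<in> hahn_space d"
    using assms(1) by (simp add: d hahn_space_geometric_iff)
  have conv: "seq_conv a x \<in> hahn_space d" if "a \<in> hahn_space d" "x \<in> hahn_space d" for a x
    using that summable_weighted_seq_conv [of r a x] assms(1)
    by (simp add: d hahn_space_geometric_iff)
  show ?thesis
  proof (rule set_eqI, rule iffI)
    fix a
    assume "a \<in> multipliers (hahn_space d)"
    \<comment> \<open>Testing a multiplier on the convolution unit returns the multiplier itself,
      which must therefore lie in the space.\<close>
    then have "seq_conv a ?e \<in> hahn_space d"
      using unit unfolding multipliers_def by blast
    then show "a \<in> hahn_space d"
      by (simp only: seq_conv_unit)
  next
    fix a
    assume "a \<in> hahn_space d"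
    then show "a \<in> multipliers (hahn_space d)"
      unfolding multipliers_def using conv by blast
  qed
qed

end
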